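(* In the setting described in the context (Swift–Hohenberg equation with impurity $\varepsilon g(x,u)$, with the three assumptions listed there), let $k_1=k_1(\varepsilon,k_0,\varphi_0)$ be the wavenumber difference in the family of stationary solutions described there, and let $M_k(\varphi_0,0)$ be its leading-order coefficient. Assume that $g\in H^1_{\gamma_*}$, $\gamma_*>6$, $M_k(\varphi_*,0)=0$, and $M_k'(\varphi_*,0)\neq0$, where $'$ denotes the derivative with respect to the first argument. Then there exist $\bar\varepsilon,\bar k_0>0$ and a function $\phi_0(\varepsilon,k_0):[0,\bar\varepsilon]\times[0,\bar k_0]\to\mathbb{R}$ with $\phi_0(0,0)=\varphi_*$ such that the wavenumber difference $k_1$ vanishes for $\varphi_0=\phi_0(\varepsilon,k_0)$.
   Context: Notation: $\lfloor x\rfloor=\sqrt{1+x^2}$; $H^s_\gamma$ is the space of $u\in L^1_{\mathrm{loc}}(\mathbb{R})$ with $\lfloor x\rfloor^\gamma\partial_x^\alpha u\in L^2(\mathbb{R})$ for integers $0\le\alpha\le s$. The condition $g\in H^1_{\gamma_*}$ refers to $g$ as a function of $x$. $\chi_\pm$ is a smooth partition of unity on $\mathbb{R}$ with $\mathrm{supp}(\chi_+)\subset(-1,\infty)$, $\chi_-(x)=\chi_+(-x)$. Setting: $\mu>0$ is fixed, and we consider stationary solutions of $$u_t=-(\partial_x^2+1)^2u+\mu u-u^3+\varepsilon g(x,u),\quad x\in\mathbb{R}.$$ Assumptions: (1) $g$ is smooth and $|\partial_x^{j_1}\partial_u^{j_2}g(x,u)|\le(1+|x|)^{-\gamma_*}$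 for $j_1+j_2\le3$, with $\gamma_*>6$. (2) There is an even, $2\pi$-periodic solution $u_{\mathrm p}(\xi;k_* )$, $k_*>0$, of $-(k_*^2\partial_\xi^2+1)^2u+\mu u-u^3=0$. (3) For $L_{\mathrm B}(\sigma)=-(1+(\partial_x+\mathrm i\sigma)^2)^2+\mu-3u_{\mathrm p}^2(k_*x;k_* )$, $\sigma\in[0,k_* )$, with domain $H^4_{\mathrm{per}}(0,2\pi/k_* )\subset L^2_{\mathrm{per}}(0,2\pi/k_* )$: $0\in\mathrm{spec}(L_{\mathrm B}(\sigma))$ precisely for $\sigma=0$, where $0$ is an algebraically simple eigenvalue with eigenfunction $\partial_x[u_{\mathrm p}(k_*x;k_* )]$; its continuation for $\sigma\sim0$ is $\lambda(\sigma)=\lambda_2\sigma^2+O(\sigma^3)$ with $\lambda_2\neq0$. Under (2), (3) there is a smooth family $u_{\mathrm p}(\xi;k)$, $k\sim k_*$, of even, $2\pi$-periodic solutions of $-(1+k^2\partial_\xi^2)^2u+\mu u-u^3=0$ continuing $u_{\mathrm p}(\cdot;k_* )$. Definition of $k_1$: under (1)–(3), there exist $\varepsilon_0>0$ and a family of stationary solutions, parameterized by $k_0,\varphi_0$, of the form $$u(x;\varepsilon)=\sum_\pm\chi_\pm(x)u_{\mathrm p}((k_*+k_0\pm k_1)x-\varphi_0\mp\varphi_1;k_*+k_0\pm k_1)+w(x)$$ with $w$ algebraically localized and $k_1,\varphi_1$ $C^1$-functions of $\varepsilon,k_0\in(-\varepsilon_0,\varepsilon_0)$, $\varphi_0\in\mathbb{R}$.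 One has $k_1=\varepsilon M_k(\varphi_0,k_0)+O(\varepsilon^2)$, where for $k_0=0$ $$M_k(\varphi_0,0)=\frac{\pi\int_{\mathbb R}g(x,u_{\mathrm p}(k_*x-\varphi_0;k_* ))\,\partial_\xi u_{\mathrm p}(k_*x-\varphi_0;k_* )\,dx}{\lambda_2k_*\int_0^{2\pi/k_*}(\partial_\xi u_{\mathrm p}(k_*x;k_* ))^2\,dx}.$$ *)

theory Defs
  imports "HOL-Analysis.Analysis" "HOL-Library.Landau_Symbols"
begin

section \<open>Smooth functions\<close>

text \<open>Intended for open \<open>S\<close>: all directional derivatives up to order \<open>n\<close> exist and are continuous.\<close>

primrec Ck_on :: "nat \<Rightarrow> 'a::real_normed_vector set \<Rightarrow> ('a \<Rightarrow> 'b::real_normed_vector) \<Rightarrow> bool" where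
  "Ck_on 0 S f \<longleftrightarrow> continuous_on S f"
| "Ck_on (Suc n) S f \<longleftrightarrow>
     (\<forall>x\<in>S. f differentiable (at x)) \<and>
     (\<forall>v. Ck_on n S (\<lambda>x. frechet_derivative f (at x) v))"

definition smooth_on :: "'a::real_normed_vector set \<Rightarrow> ('a \<Rightarrow> 'b::real_normed_vector) \<Rightarrow> bool" where
  "smooth_on S f \<longleftrightarrow> (\<forall>n. Ck_on n S f)"

section \<open>Weak derivatives and weighted Sobolev spaces on the line\<close>

definition ae_eq :: "(real \<Rightarrow> 'a) \<Rightarrow> (real \<Rightarrow> 'a) \<Rightarrow> bool" where
  "ae_eq u v \<longleftrightarrow> (AE x in lebesgue. u x = v x)"

definition L1_loc :: "(real \<Rightarrow> 'a::euclidean_space) \<Rightarrow> bool" where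
  "L1_loc u \<longleftrightarrow> (\<forall>a b. u absolutely_integrable_on {a..b})"

definition square_integrable :: "(real \<Rightarrow> 'a::euclidean_space) \<Rightarrow> bool" where
  "square_integrable u \<longleftrightarrow>
     u \<in> borel_measurable lebesgue \<and> integrable lebesgue (\<lambda>x. (norm (u x))\<^sup>2)"

definition test_function :: "(real \<Rightarrow> real) \<Rightarrow> bool" where
  "test_function \<theta> \<longleftrightarrow> smooth_on UNIV \<theta> \<and> compact (closure {x. \<theta> x \<noteq> 0})"

definition has_weak_deriv :: "nat \<Rightarrow> (real \<Rightarrow> 'a::euclidean_space) \<Rightarrow> (real \<Rightarrow> 'a) \<Rightarrow> bool" where
  "has_weak_deriv n u v \<longleftrightarrow> L1_loc u \<and> L1_loc v \<and>
     (\<forall>\<theta>. test_function \<theta> \<longrightarrow>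
        integral\<^sup>L lebesgue (\<lambda>x. (deriv ^^ n) \<theta> x *\<^sub>R u x)
        = (-1) ^ n *\<^sub>R integral\<^sup>L lebesgue (\<lambda>x. \<theta> x *\<^sub>R v x))"

text \<open>Determined only up to null sets, and meaningful only if a weak derivative exists.\<close>

definition weak_deriv :: "(real \<Rightarrow> 'a::euclidean_space) \<Rightarrow> real \<Rightarrow> 'a" where
  "weak_deriv u = (SOME v. has_weak_deriv 1 u v)"

definition jbracket :: "real \<Rightarrow> real" where
  "jbracket x = sqrt (1 + x\<^sup>2)"

definition weighted_Sobolev :: "nat \<Rightarrow> real \<Rightarrow> (real \<Rightarrow> real) set" where
  "weighted_Sobolev s \<gamma> = {u. L1_loc u \<and>
     (\<forall>\<alpha>\<le>s. \<exists>v. has_weak_deriv \<alpha> u v \<and> square_integrable (\<lambda>x. jbracket x powr \<gamma> * v x))}"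

definition algebraically_localized :: "(real \<Rightarrow> real) \<Rightarrow> bool" where
  "algebraically_localized w \<longleftrightarrow> (\<exists>\<gamma>>0. \<exists>C. \<forall>x. \<bar>w x\<bar> \<le> C * jbracket x powr (- \<gamma>))"

section \<open>Periodic Sobolev spaces and spectra of unbounded operators\<close>

text \<open>
  Elements of \<open>L\<^sup>2\<^sub>per(0,T)\<close> are represented by functions on the whole line that are
  \<open>T\<close>-periodic almost everywhere; equality in the space is \<^const>\<open>ae_eq\<close>. Taking weak
  derivatives of the periodic extension on the line builds the periodic boundary conditions
  into \<open>H\<^sup>s\<^sub>per(0,T)\<close>.
\<close>

definition L2_per :: "real \<Rightarrow> (real \<Rightarrow> complex) set" where
  "L2_per T = {u. u \<in> borel_measurable lebesgue \<and>
     (AE x in lebesgue. u (x + T) = u x) \<and>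
     set_integrable lebesgue {0..T} (\<lambda>x. (cmod (u x))\<^sup>2)}"

definition L2_per_norm :: "real \<Rightarrow> (real \<Rightarrow> complex) \<Rightarrow> real" where
  "L2_per_norm T u = sqrt (LINT x:{0..T}|lebesgue. (cmod (u x))\<^sup>2)"

definition H_per :: "nat \<Rightarrow> real \<Rightarrow> (real \<Rightarrow> complex) set" where
  "H_per s T = {u \<in> L2_per T. \<forall>\<alpha>\<le>s. \<exists>v \<in> L2_per T. has_weak_deriv \<alpha> u v}"

text \<open>
  Spectrum of an operator \<open>A\<close> on \<open>L\<^sup>2\<^sub>per(0,T)\<close> with domain \<open>D\<close>: \<open>z\<close> is in the resolvent set iff
  \<open>A - z\<close> is a bijection from \<open>D\<close> onto \<open>L\<^sup>2\<^sub>per(0,T)\<close> with bounded inverse. The lower bound in the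
  second conjunct expresses injectivity together with boundedness of the inverse.
\<close>

definition spec_per ::
    "real \<Rightarrow> (real \<Rightarrow> complex) set \<Rightarrow> ((real \<Rightarrow> complex) \<Rightarrow> real \<Rightarrow> complex) \<Rightarrow> complex set" where
  "spec_per T D A = {z. \<not>
     ((\<forall>f \<in> L2_per T. \<exists>u \<in> D. ae_eq (\<lambda>x. A u x - z * u x) f) \<and>
      (\<exists>C. \<forall>u \<in> D. L2_per_norm T u \<le> C * L2_per_norm T (\<lambda>x. A u x - z * u x)))}"

definition eigenvalue ::
    "(real \<Rightarrow> complex) set \<Rightarrow> ((real \<Rightarrow> complex) \<Rightarrow> real \<Rightarrow> complex) \<Rightarrow> complex \<Rightarrow> bool" where
  "eigenvalue D A z \<longleftrightarrow>
     (\<exists>u \<in> D. \<not> ae_eq u (\<lambda>_. 0) \<and> ae_eq (A u) (\<lambda>x. z * u x))"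

text \<open>The kernel of \<open>(A - z)\<^sup>n\<close> on its natural domain.\<close>

primrec power_kernel ::
    "(real \<Rightarrow> complex) set \<Rightarrow> ((real \<Rightarrow> complex) \<Rightarrow> real \<Rightarrow> complex) \<Rightarrow> complex \<Rightarrow> nat
      \<Rightarrow> (real \<Rightarrow> complex) set" where
  "power_kernel D A z 0 = {u. ae_eq u (\<lambda>_. 0)}"
| "power_kernel D A z (Suc n) = {u \<in> D. (\<lambda>x. A u x - z * u x) \<in> power_kernel D A z n}"

text \<open>Algebraic simplicity: the generalized eigenspace is the line spanned by the eigenfunction.\<close>

definition alg_simple_eigenvalue ::
    "(real \<Rightarrow> complex) set \<Rightarrow> ((real \<Rightarrow> complex) \<Rightarrow> real \<Rightarrow> complex) \<Rightarrow> complex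
      \<Rightarrow> (real \<Rightarrow> complex) \<Rightarrow> bool" where
  "alg_simple_eigenvalue D A z e \<longleftrightarrow>
     e \<in> D \<and> \<not> ae_eq e (\<lambda>_. 0) \<and> ae_eq (A e) (\<lambda>x. z * e x) \<and>
     (\<Union>n. power_kernel D A z n) = {u. \<exists>c. ae_eq u (\<lambda>x. c * e x)}"

section \<open>Swift--Hohenberg equation with an impurity\<close>

text \<open>The operator \<open>1 + k\<^sup>2 \<partial>\<^sup>2\<close> on classical functions.\<close>

definition helm :: "real \<Rightarrow> (real \<Rightarrow> real) \<Rightarrow> real \<Rightarrow> real" where
  "helm k f = (\<lambda>x. f x + k\<^sup>2 * (deriv ^^ 2) f x)"

definition stationary_solution ::
    "real \<Rightarrow> (real \<Rightarrow> real \<Rightarrow> real) \<Rightarrow> real \<Rightarrow> (real \<Rightarrow> real) \<Rightarrow> bool" where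
  "stationary_solution \<mu> g \<epsilon> u \<longleftrightarrow> Ck_on 4 UNIV u \<and>
     (\<forall>x. - helm 1 (helm 1 u) x + \<mu> * u x - (u x) ^ 3 + \<epsilon> * g x (u x) = 0)"

definition impurity_assumption :: "(real \<Rightarrow> real \<Rightarrow> real) \<Rightarrow> real \<Rightarrow> bool" where
  "impurity_assumption g \<gamma> \<longleftrightarrow> \<gamma> > 6 \<and>
     smooth_on UNIV (\<lambda>(x, u). g x u) \<and>
     (\<forall>j1 j2 x u. j1 + j2 \<le> 3 \<longrightarrow>
        \<bar>(deriv ^^ j1) (\<lambda>y. (deriv ^^ j2) (g y) u) x\<bar> \<le> (1 + \<bar>x\<bar>) powr (- \<gamma>))"

definition stripe :: "real \<Rightarrow> real \<Rightarrow> (real \<Rightarrow> real) \<Rightarrow> bool" where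
  "stripe \<mu> k u \<longleftrightarrow> Ck_on 4 UNIV u \<and>
     (\<forall>\<xi>. u (- \<xi>) = u \<xi>) \<and> (\<forall>\<xi>. u (\<xi> + 2 * pi) = u \<xi>) \<and>
     (\<forall>\<xi>. - helm k (helm k u) \<xi> + \<mu> * u \<xi> - (u \<xi>) ^ 3 = 0)"

text \<open>
  The operators \<open>\<partial>\<^sub>x + i\<sigma>\<close>, \<open>1 + (\<partial>\<^sub>x + i\<sigma>)\<^sup>2\<close> and
  \<open>-(1 + (\<partial>\<^sub>x + i\<sigma>)\<^sup>2)\<^sup>2 + \<mu> - 3 u\<^sub>p(kx)\<^sup>2\<close>, with \<open>\<partial>\<^sub>x\<close> the weak derivative.
\<close>

definition bloch_d :: "real \<Rightarrow> (real \<Rightarrow> complex) \<Rightarrow> real \<Rightarrow> complex" where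
  "bloch_d \<sigma> v = (\<lambda>x. weak_deriv v x + \<i> * of_real \<sigma> * v x)"

definition bloch_helm :: "real \<Rightarrow> (real \<Rightarrow> complex) \<Rightarrow> real \<Rightarrow> complex" where
  "bloch_helm \<sigma> v = (\<lambda>x. v x + bloch_d \<sigma> (bloch_d \<sigma> v) x)"

definition L_B ::
    "real \<Rightarrow> real \<Rightarrow> (real \<Rightarrow> real) \<Rightarrow> real \<Rightarrow> (real \<Rightarrow> complex) \<Rightarrow> real \<Rightarrow> complex" where
  "L_B \<mu> k up \<sigma> v =
     (\<lambda>x. - bloch_helm \<sigma> (bloch_helm \<sigma> v) x + of_real (\<mu> - 3 * (up (k * x))\<^sup>2) * v x)"

text \<open>
  In the last conjunct, \<open>lam\<close> is the continuation of the simple eigenvalue \<open>0\<close> to \<open>\<sigma>\<close> near \<open>0\<close>.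
\<close>

definition spectral_assumption :: "real \<Rightarrow> real \<Rightarrow> (real \<Rightarrow> real) \<Rightarrow> real \<Rightarrow> bool" where
  "spectral_assumption \<mu> k up lam2 \<longleftrightarrow>
     (let T = 2 * pi / k; D = H_per 4 T; L = L_B \<mu> k up in
       (\<forall>\<sigma> \<in> {0..<k}. 0 \<in> spec_per T D (L \<sigma>) \<longleftrightarrow> \<sigma> = 0) \<and>
       alg_simple_eigenvalue D (L 0) 0 (\<lambda>x. of_real (deriv (\<lambda>y. up (k * y)) x)) \<and>
       lam2 \<noteq> 0 \<and>
       (\<exists>\<delta>>0. \<exists>lam :: real \<Rightarrow> complex.
          continuous_on {-\<delta><..<\<delta>} lam \<and> lam 0 = 0 \<and>
          (\<forall>\<sigma> \<in> {-\<delta><..<\<delta>}. eigenvalue D (L \<sigma>) (lam \<sigma>)) \<and>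
          (\<lambda>\<sigma>. lam \<sigma> - of_real (lam2 * \<sigma>\<^sup>2)) \<in> O[at 0](\<lambda>\<sigma>. of_real (\<sigma> ^ 3))))"

text \<open>The family \<open>u\<^sub>p(\<xi>;k)\<close>, written \<open>up \<xi> k\<close>, for \<open>k\<close> in the open neighbourhood \<open>K\<close> of \<open>kstar\<close>.\<close>

definition stripe_family :: "real \<Rightarrow> real \<Rightarrow> real set \<Rightarrow> (real \<Rightarrow> real \<Rightarrow> real) \<Rightarrow> bool" where
  "stripe_family \<mu> kstar K up \<longleftrightarrow> open K \<and> kstar \<in> K \<and>
     smooth_on (UNIV \<times> K) (\<lambda>(\<xi>, k). up \<xi> k) \<and>
     (\<forall>k \<in> K. stripe \<mu> k (\<lambda>\<xi>. up \<xi> k))"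

text \<open>The argument \<open>chi\<close> is \<open>\<chi>\<^sub>+\<close>, and \<open>\<chi>\<^sub>-(x) = \<chi>\<^sub>+(-x)\<close>.\<close>

definition stripe_partition :: "(real \<Rightarrow> real) \<Rightarrow> bool" where
  "stripe_partition chi \<longleftrightarrow> smooth_on UNIV chi \<and> (\<forall>x. 0 \<le> chi x) \<and> (\<forall>x. chi x + chi (- x) = 1) \<and>
     closure {x. chi x \<noteq> 0} \<subseteq> {-1<..}"

text \<open>
  \<open>u \<epsilon> k0 \<phi>0\<close> is the stationary solution; \<open>k1\<close> and \<open>\<phi>1\<close> take the arguments \<open>\<epsilon> k0 \<phi>0\<close>.
\<close>

definition deformed_stripes ::
    "real \<Rightarrow> (real \<Rightarrow> real \<Rightarrow> real) \<Rightarrow> real \<Rightarrow> real set \<Rightarrow> (real \<Rightarrow> real \<Rightarrow> real) \<Rightarrow> (real \<Rightarrow> real) \<Rightarrow> real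
      \<Rightarrow> (real \<Rightarrow> real \<Rightarrow> real \<Rightarrow> real \<Rightarrow> real) \<Rightarrow> (real \<Rightarrow> real \<Rightarrow> real \<Rightarrow> real)
      \<Rightarrow> (real \<Rightarrow> real \<Rightarrow> real \<Rightarrow> real) \<Rightarrow> bool" where
  "deformed_stripes \<mu> g kstar K up chi \<epsilon>0 u k1 \<phi>1 \<longleftrightarrow> \<epsilon>0 > 0 \<and>
     Ck_on 1 ({-\<epsilon>0<..<\<epsilon>0} \<times> {-\<epsilon>0<..<\<epsilon>0} \<times> UNIV) (\<lambda>(\<epsilon>, k0, \<phi>0). k1 \<epsilon> k0 \<phi>0) \<and>
     Ck_on 1 ({-\<epsilon>0<..<\<epsilon>0} \<times> {-\<epsilon>0<..<\<epsilon>0} \<times> UNIV) (\<lambda>(\<epsilon>, k0, \<phi>0). \<phi>1 \<epsilon> k0 \<phi>0) \<and>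
     (\<forall>\<epsilon> \<in> {-\<epsilon>0<..<\<epsilon>0}. \<forall>k0 \<in> {-\<epsilon>0<..<\<epsilon>0}. \<forall>\<phi>0.
        let kp = kstar + k0 + k1 \<epsilon> k0 \<phi>0; km = kstar + k0 - k1 \<epsilon> k0 \<phi>0;
            \<phi>p = \<phi>0 + \<phi>1 \<epsilon> k0 \<phi>0; \<phi>m = \<phi>0 - \<phi>1 \<epsilon> k0 \<phi>0
        in kp \<in> K \<and> km \<in> K \<and> stationary_solution \<mu> g \<epsilon> (u \<epsilon> k0 \<phi>0) \<and>
           algebraically_localized
             (\<lambda>x. u \<epsilon> k0 \<phi>0 x - (chi x * up (kp * x - \<phi>p) kp + chi (- x) * up (km * x - \<phi>m) km)))"

text \<open>The coefficient \<open>M\<^sub>k(\<phi>,0)\<close>, with \<open>up\<close> standing for \<open>u\<^sub>p(\<cdot>;k)\<close> at \<open>k = k\<^sub>*\<close>.\<close>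

definition melnikov_k ::
    "(real \<Rightarrow> real \<Rightarrow> real) \<Rightarrow> real \<Rightarrow> (real \<Rightarrow> real) \<Rightarrow> real \<Rightarrow> real \<Rightarrow> real" where
  "melnikov_k g k up lam2 \<phi> =
     pi * (LINT x|lborel. g x (up (k * x - \<phi>)) * deriv up (k * x - \<phi>)) /
     (lam2 * k * (LINT x:{0..2 * pi / k}|lborel. (deriv up (k * x))\<^sup>2))"

text \<open>
  The expansion \<open>k1 = \<epsilon> M\<^sub>k(\<phi>0,k0) + O(\<epsilon>\<^sup>2)\<close> is required pointwise in \<open>k0\<close> and \<open>\<phi>0\<close>, without
  uniformity of the remainder.
\<close>

definition leading_order ::
    "(real \<Rightarrow> real \<Rightarrow> real) \<Rightarrow> real \<Rightarrow> (real \<Rightarrow> real) \<Rightarrow> real \<Rightarrow> real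
      \<Rightarrow> (real \<Rightarrow> real \<Rightarrow> real \<Rightarrow> real) \<Rightarrow> (real \<Rightarrow> real \<Rightarrow> real) \<Rightarrow> bool" where
  "leading_order g kstar up lam2 \<epsilon>0 k1 M \<longleftrightarrow>
     (\<forall>k0 \<in> {-\<epsilon>0<..<\<epsilon>0}. \<forall>\<phi>0.
        (\<lambda>\<epsilon>. k1 \<epsilon> k0 \<phi>0 - \<epsilon> * M \<phi>0 k0) \<in> O[at 0](\<lambda>\<epsilon>. \<epsilon>\<^sup>2)) \<and>
     (\<forall>\<phi>0. M \<phi>0 0 = melnikov_k g kstar up lam2 \<phi>0)"

end

theory Submission
  imports Defs
begin

text \<open>
  Write \<open>D\<close> for the partial derivative of \<open>k\<^sub>1\<close> in \<open>\<epsilon>\<close>, a continuous function of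
  \<open>(\<epsilon>, k\<^sub>0, \<phi>\<^sub>0)\<close>. The expansion \<open>k\<^sub>1 = \<epsilon> M\<^sub>k + O(\<epsilon>\<^sup>2)\<close> says that \<open>k\<^sub>1\<close> vanishes
  identically at \<open>\<epsilon> = 0\<close> and that \<open>D(0, k\<^sub>0, \<phi>\<^sub>0) = M\<^sub>k(\<phi>\<^sub>0, k\<^sub>0)\<close>. The first fact makes
  every phase a zero when \<open>\<epsilon> = 0\<close>, so \<open>\<phi>\<^sub>*\<close> may be chosen there.

  For \<open>\<epsilon> > 0\<close>, one would like to apply the implicit function theorem to \<open>k\<^sub>1/\<epsilon>\<close>. Since
  \<open>k\<^sub>1\<close> is merely \<open>C\<^sup>1\<close>, this quotient is only known to be continuous at \<open>\<epsilon> = 0\<close>, but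
  the existence of a zero needs no more than a change of sign. The simple zero of
  \<open>M\<^sub>k(\<cdot>, 0)\<close> at \<open>\<phi>\<^sub>*\<close> yields phases \<open>a\<close>, \<open>b\<close> with \<open>D(0, 0, a) < 0 < D(0, 0, b)\<close>.
  By continuity \<open>D(\<cdot>, \<cdot>, a)\<close> and \<open>D(\<cdot>, \<cdot>, b)\<close> keep these signs
  for small \<open>(\<epsilon>, k\<^sub>0)\<close>. By the mean value theorem in \<open>\<epsilon>\<close>, started from the zero at \<open>\<epsilon> = 0\<close>,
  \<open>k\<^sub>1\<close> inherits them (lemma \<open>sign_from_partial_derivative\<close>), and the intermediate value
  theorem in \<open>\<phi>\<^sub>0\<close> gives a zero (lemma \<open>zero_of_partial_derivative_sign_change\<close>).
\<close>

lemma has_derivative_imp_partial_real_derivative: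
  fixes f :: "real \<times> 'a::real_normed_vector \<Rightarrow> real"
  assumes "(f has_derivative f') (at (t, y))"
  shows "((\<lambda>s. f (s, y)) has_real_derivative f' (1, 0)) (at t)"
proof -
  have "((\<lambda>s. (s, y)) has_derivative (\<lambda>h. (h, 0))) (at t)"
    by (auto intro!: derivative_eq_intros)
  then have "((\<lambda>s. f (s, y)) has_derivative (\<lambda>h. f' (h, 0))) (at t)"
    using has_derivative_compose[of "\<lambda>s. (s, y)" "\<lambda>h. (h, 0)" t UNIV f f'] assms by simp
  moreover have "f' (h, 0) = f' (1, 0) * h" for h
    using linear_cmul[OF has_derivative_linear[OF assms], of h "(1, 0)"] by (simp add: mult.commute)
  then have "(\<lambda>h. f' (h, 0)) = (*) (f' (1, 0))"
    by (rule ext)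
  ultimately show ?thesis
    by (simp only: has_field_derivative_def)
qed

text \<open>
  A quadratic remainder in a punctured neighbourhood determines the value at \<open>0\<close> by continuity,
  and then the derivative.
\<close>

lemma first_order_expansion:
  fixes h :: "real \<Rightarrow> real"
  assumes cont: "isCont h 0" and exp: "(\<lambda>e. h e - e * m) \<in> O[at 0](\<lambda>e. e\<^sup>2)"
  shows "h 0 = 0" and "(h has_real_derivative m) (at 0)"
proof -
  from exp obtain C where C: "\<forall>\<^sub>F e in at 0. norm (h e - e * m) \<le> C * norm (e\<^sup>2)"
    by (rule landau_o.bigE)
  have "((\<lambda>e. C * norm (e\<^sup>2)) \<longlongrightarrow> 0) (at (0::real))"
    by (auto intro!: tendsto_eq_intros)
  then have "((\<lambda>e. h e - e * m) \<longlongrightarrow> 0) (at 0)"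
    by (rule Lim_null_comparison[OF C])
  moreover have "((\<lambda>e. h e - e * m) \<longlongrightarrow> h 0) (at 0)"
    using cont by (auto intro!: tendsto_eq_intros simp: isCont_def)
  ultimately show h0: "h 0 = 0"
    using LIM_unique by blast
  have "\<forall>\<^sub>F e in at 0. norm (h e / e - m) \<le> C * \<bar>e\<bar>"
    using C eventually_neq_at_within[of 0 0 UNIV]
  proof eventually_elim
    case (elim e)
    then have "h e / e - m = (h e - e * m) / e"
      by (simp add: diff_divide_distrib)
    then have "norm (h e / e - m) = norm (h e - e * m) / \<bar>e\<bar>"
      by simp
    also have "\<dots> \<le> C * norm (e\<^sup>2) / \<bar>e\<bar>"
      using elim by (intro divide_right_mono) auto
    also have "\<dots> = C * \<bar>e\<bar>"
      using elim by (simp add: divide_simps power2_eq_square)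
    finally show ?case .
  qed
  moreover have "((\<lambda>e. C * \<bar>e\<bar>) \<longlongrightarrow> 0) (at (0::real))"
    by (auto intro!: tendsto_eq_intros)
  ultimately have "((\<lambda>e. h e / e - m) \<longlongrightarrow> 0) (at 0)"
    by (rule Lim_null_comparison)
  then have "((\<lambda>e. h e / e) \<longlongrightarrow> m) (at 0)"
    by (simp add: Lim_null[of "\<lambda>e. h e / e"])
  then show "(h has_real_derivative m) (at 0)"
    by (simp add: DERIV_def h0)
qed

lemma simple_zero_imp_sign_change:
  fixes f :: "real \<Rightarrow> real"
  assumes "(f has_real_derivative m) (at x)" and "m \<noteq> 0" and "f x = 0"
  obtains a b where "f a < 0" and "0 < f b"
proof (cases "0 < m")
  case True
  then obtain d e where d: "d > 0" "\<forall>h>0. h < d \<longrightarrow> f (x - h) < f x"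
    and e: "e > 0" "\<forall>h>0. h < e \<longrightarrow> f x < f (x + h)"
    using DERIV_pos_inc_left[OF assms(1)] DERIV_pos_inc_right[OF assms(1)] by blast
  show ?thesis
    using that[of "x - d / 2" "x + e / 2"] d e assms(3) by simp
next
  case False
  then have "m < 0"
    using assms(2) by simp
  then obtain d e where d: "d > 0" "\<forall>h>0. h < d \<longrightarrow> f x < f (x - h)"
    and e: "e > 0" "\<forall>h>0. h < e \<longrightarrow> f (x + h) < f x"
    using DERIV_neg_dec_left[OF assms(1)] DERIV_neg_dec_right[OF assms(1)] by blast
  show ?thesis
    using that[of "x + e / 2" "x - d / 2"] d e assms(3) by simp
qed

text \<open>
  The mean value theorem turns the sign of the partial derivative at the origin into the sign of
  the function for small \<open>t > 0\<close>, uniformly in the parameter \<open>y\<close>: the intermediate point depends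
  on \<open>y\<close> but stays in the neighbourhood of the origin where the derivative is positive.
\<close>

lemma sign_from_partial_derivative:
  fixes f D :: "real \<Rightarrow> 'a::real_normed_vector \<Rightarrow> real"
  assumes deriv: "\<And>t y. \<bar>t\<bar> < r \<Longrightarrow> norm y < r \<Longrightarrow>
      ((\<lambda>s. f s y) has_real_derivative D t y) (at t)"
    and zero: "\<And>y. norm y < r \<Longrightarrow> f 0 y = 0"
    and "isCont (\<lambda>(t, y). D t y) (0, 0)" and "D 0 0 > 0" and "r > 0"
  obtains d where "0 < d" and "d < r"
    and "\<And>t y. 0 < t \<Longrightarrow> t \<le> d \<Longrightarrow> norm y \<le> d \<Longrightarrow> 0 < f t y"
proof -
  have "((\<lambda>(t, y). D t y) \<longlongrightarrow> (\<lambda>(t, y). D t y) (0, 0)) (nhds (0, 0))"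
    using assms(3) unfolding isCont_def tendsto_at_iff_tendsto_nhds .
  then have "\<forall>\<^sub>F p in nhds (0, 0). 0 < (\<lambda>(t, y). D t y) p"
    by (rule order_tendstoD(1)) (simp add: \<open>D 0 0 > 0\<close>)
  then obtain e where e: "e > 0" "\<And>t y. dist (t, y) (0, 0) < e \<Longrightarrow> 0 < D t y"
    by (auto simp: eventually_nhds_metric)
  define d where "d = min r e / 3"
  have "0 < f t y" if t: "0 < t" "t \<le> d" "norm y \<le> d" for t y
  proof -
    have y: "norm y < r"
      using t \<open>r > 0\<close> e(1) by (simp add: d_def)
    have "((\<lambda>s. f s y) has_real_derivative D s y) (at s)" if "0 \<le> s" "s \<le> t" for s
      using that t y \<open>r > 0\<close> e(1) by (intro deriv) (auto simp: d_def)
    from MVT2[OF t(1) this] obtain z where z: "0 < z" "z < t" "f t y - f 0 y = (t - 0) * D z y"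
      by blast
    have "dist (z, y) (0, 0) \<le> \<bar>z\<bar> + norm y"
      using sqrt_sum_squares_le_sum_abs[of z "norm y"] by (simp add: dist_norm norm_Pair)
    also have "\<dots> < e"
      using z t \<open>r > 0\<close> e(1) by (simp add: d_def)
    finally have "0 < D z y"
      by (rule e(2))
    then show ?thesis
      using z(3) t(1) zero[OF y] by simp
  qed
  moreover have "0 < d" "d < r"
    using \<open>r > 0\<close> e(1) by (auto simp: d_def)
  ultimately show ?thesis
    using that by blast
qed

text \<open>
  Differentiability of \<open>f / t\<close> across \<open>t = 0\<close>, hence the implicit function theorem, is avoided:
  at fixed \<open>t\<close> and \<open>y\<close> the function changes sign between the phases \<open>a\<close> and \<open>b\<close>.
\<close>

lemma zero_of_partial_derivative_sign_change:
  fixes f D :: "real \<Rightarrow> real \<Rightarrow> real \<Rightarrow> real"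
  assumes deriv: "\<And>t y \<phi>. \<bar>t\<bar> < r \<Longrightarrow> \<bar>y\<bar> < r \<Longrightarrow>
      ((\<lambda>s. f s y \<phi>) has_real_derivative D t y \<phi>) (at t)"
    and zero: "\<And>y \<phi>. \<bar>y\<bar> < r \<Longrightarrow> f 0 y \<phi> = 0"
    and contD: "\<And>\<phi>. isCont (\<lambda>(t, y). D t y \<phi>) (0, 0)"
    and contf: "\<And>t y. \<bar>t\<bar> < r \<Longrightarrow> \<bar>y\<bar> < r \<Longrightarrow> continuous_on UNIV (f t y)"
    and a: "D 0 0 a < 0" and b: "0 < D 0 0 b" and "r > 0"
  obtains d where "0 < d" and "d < r"
    and "\<And>t y. 0 \<le> t \<Longrightarrow> t \<le> d \<Longrightarrow> \<bar>y\<bar> \<le> d \<Longrightarrow> \<exists>\<phi>. f t y \<phi> = 0"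
proof -
  obtain d1 where d1: "0 < d1" "d1 < r"
    "\<And>t y. 0 < t \<Longrightarrow> t \<le> d1 \<Longrightarrow> norm y \<le> d1 \<Longrightarrow> 0 < f t y b"
    using sign_from_partial_derivative[of r "\<lambda>t y. f t y b" "\<lambda>t y. D t y b"]
      deriv zero contD b \<open>r > 0\<close> by (auto simp: case_prod_unfold)
  obtain d2 where d2: "0 < d2" "d2 < r"
    "\<And>t y. 0 < t \<Longrightarrow> t \<le> d2 \<Longrightarrow> norm y \<le> d2 \<Longrightarrow> 0 < - f t y a"
  proof (rule sign_from_partial_derivative[of r "\<lambda>t y. - f t y a" "\<lambda>t y. - D t y a"])
    show "isCont (\<lambda>(t, y). - D t y a) (0, 0)"
      using contD[of a] by (auto simp: case_prod_unfold)
  qed (use deriv zero a \<open>r > 0\<close> in \<open>auto intro!: DERIV_minus\<close>)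
  define d where "d = min d1 d2"
  have "\<exists>\<phi>. f t y \<phi> = 0" if t: "0 \<le> t" "t \<le> d" "\<bar>y\<bar> \<le> d" for t y
  proof (cases "t = 0")
    case True
    then show ?thesis
      using zero[of y] t(3) d1(2) by (auto simp: d_def)
  next
    case False
    have "connected (range (f t y))"
      using contf[of t y] t d1(2) by (intro connected_continuous_image) (auto simp: d_def)
    moreover have "f t y a \<le> 0" and "0 \<le> f t y b"
      using d1(3)[of t y] d2(3)[of t y] t False by (auto simp: d_def)
    ultimately have "0 \<in> range (f t y)"
      by (rule connectedD_interval[OF _ rangeI rangeI])
    then show ?thesis
      by (metis imageE)
  qed
  moreover have "0 < d" "d < r"
    using d1 d2 by (auto simp: d_def)
  ultimately show ?thesis
    using that by blast
qed

theorem corollary2p5: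
  fixes \<mu> kstar \<gamma>star lam2 \<epsilon>0 \<phi>star :: real
    and g up :: "real \<Rightarrow> real \<Rightarrow> real"
    and K :: "real set"
    and chi :: "real \<Rightarrow> real"
    and u :: "real \<Rightarrow> real \<Rightarrow> real \<Rightarrow> real \<Rightarrow> real"
    and k1 \<phi>1 :: "real \<Rightarrow> real \<Rightarrow> real \<Rightarrow> real"
    and M :: "real \<Rightarrow> real \<Rightarrow> real"
  assumes "\<mu> > 0"
    and "impurity_assumption g \<gamma>star"
    and "kstar > 0" and "stripe \<mu> kstar (\<lambda>\<xi>. up \<xi> kstar)"
    and "spectral_assumption \<mu> kstar (\<lambda>\<xi>. up \<xi> kstar) lam2"
    and "stripe_family \<mu> kstar K up"
    and "stripe_partition chi"
    and "deformed_stripes \<mu> g kstar K up chi \<epsilon>0 u k1 \<phi>1"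
    and "leading_order g kstar (\<lambda>\<xi>. up \<xi> kstar) lam2 \<epsilon>0 k1 M"
    and "\<And>v. (\<lambda>x. g x v) \<in> weighted_Sobolev 1 \<gamma>star"
    and "M \<phi>star 0 = 0"
    and "\<exists>M'. ((\<lambda>\<phi>. M \<phi> 0) has_real_derivative M') (at \<phi>star) \<and> M' \<noteq> 0"
  shows "\<exists>\<epsilon>bar kbar. 0 < \<epsilon>bar \<and> \<epsilon>bar < \<epsilon>0 \<and> 0 < kbar \<and> kbar < \<epsilon>0 \<and>
    (\<exists>\<phi>fun :: real \<Rightarrow> real \<Rightarrow> real.
       \<phi>fun 0 0 = \<phi>star \<and>
       (\<forall>\<epsilon> \<in> {0..\<epsilon>bar}. \<forall>k0 \<in> {0..kbar}. k1 \<epsilon> k0 (\<phi>fun \<epsilon> k0) = 0))"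
proof -
  define S where "S = {-\<epsilon>0<..<\<epsilon>0} \<times> {-\<epsilon>0<..<\<epsilon>0} \<times> (UNIV :: real set)"
  define k where "k = (\<lambda>(\<epsilon>, k0, \<phi>0). k1 \<epsilon> k0 \<phi>0)"
  define D where "D = (\<lambda>p. frechet_derivative k (at p) (1, 0))"
  have \<epsilon>0: "\<epsilon>0 > 0" and "Ck_on 1 S k"
    using assms(8) by (auto simp: deformed_stripes_def S_def k_def)
  then have diff: "(k has_derivative frechet_derivative k (at p)) (at p)" if "p \<in> S" for p
    using that by (simp flip: frechet_derivative_works)
  have contD: "continuous_on S D"
    using \<open>Ck_on 1 S k\<close> by (simp add: D_def zero_prod_def)
  have "open S"
    unfolding S_def by (intro open_Times) auto
  have deriv: "((\<lambda>s. k1 s y \<phi>) has_real_derivative D (t, y, \<phi>)) (at t)"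
    if "\<bar>t\<bar> < \<epsilon>0" "\<bar>y\<bar> < \<epsilon>0" for t y \<phi>
  proof -
    have "(t, y, \<phi>) \<in> S"
      using that by (auto simp: S_def)
    from has_derivative_imp_partial_real_derivative[OF diff[OF this]]
    have "((\<lambda>s. k (s, y, \<phi>)) has_real_derivative D (t, y, \<phi>)) (at t)"
      by (simp add: D_def)
    then show ?thesis
      by (simp add: k_def)
  qed
  have expansion: "(\<lambda>\<epsilon>. k1 \<epsilon> y \<phi> - \<epsilon> * M \<phi> y) \<in> O[at 0](\<lambda>\<epsilon>. \<epsilon>\<^sup>2)" if "\<bar>y\<bar> < \<epsilon>0" for y \<phi>
  proof -
    have "y \<in> {-\<epsilon>0<..<\<epsilon>0}"
      using that by auto
    then show ?thesis
      using assms(9) unfolding leading_order_def by blast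
  qed
  have zero: "k1 0 y \<phi> = 0" and D_eq_M: "D (0, y, \<phi>) = M \<phi> y" if "\<bar>y\<bar> < \<epsilon>0" for y \<phi>
  proof -
    have d: "((\<lambda>s. k1 s y \<phi>) has_real_derivative D (0, y, \<phi>)) (at 0)"
      using deriv[of 0 y \<phi>] that \<epsilon>0 by simp
    note e = first_order_expansion[OF DERIV_isCont[OF d] expansion[OF that]]
    show "k1 0 y \<phi> = 0"
      by (rule e(1))
    show "D (0, y, \<phi>) = M \<phi> y"
      by (rule DERIV_unique[OF d e(2)])
  qed
  obtain a b where "M a 0 < 0" "0 < M b 0"
    using assms(11,12) simple_zero_imp_sign_change[of "\<lambda>\<phi>. M \<phi> 0"] by blast
  then have ab: "D (0, 0, a) < 0" "0 < D (0, 0, b)"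
    using D_eq_M[of 0] \<epsilon>0 by simp_all
  have contD0: "isCont (\<lambda>(t, y). D (t, y, \<phi>)) (0, 0)" for \<phi>
  proof -
    have "isCont D (0, 0, \<phi>)"
      using contD \<open>open S\<close> \<epsilon>0 by (simp add: continuous_on_eq_continuous_at S_def)
    moreover have "isCont (\<lambda>p. (fst p, snd p, \<phi>)) (0, 0)"
      by (intro continuous_intros)
    ultimately have "isCont (\<lambda>p. D (fst p, snd p, \<phi>)) (0, 0)"
      using isCont_o2[of "(0, 0)" "\<lambda>p. (fst p, snd p, \<phi>)" D] by simp
    then show ?thesis
      by (simp add: case_prod_unfold)
  qed
  have contk: "continuous_on UNIV (k1 t y)" if "\<bar>t\<bar> < \<epsilon>0" "\<bar>y\<bar> < \<epsilon>0" for t y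
  proof -
    have "continuous_on S k"
      using diff has_derivative_continuous continuous_at_imp_continuous_on by blast
    then have "continuous_on UNIV (\<lambda>\<phi>. k (t, y, \<phi>))"
      by (rule continuous_on_compose2) (use that in \<open>auto intro!: continuous_intros simp: S_def\<close>)
    then show ?thesis
      by (simp add: k_def)
  qed
  obtain d where d: "0 < d" "d < \<epsilon>0"
    "\<And>t y. 0 \<le> t \<Longrightarrow> t \<le> d \<Longrightarrow> \<bar>y\<bar> \<le> d \<Longrightarrow> \<exists>\<phi>. k1 t y \<phi> = 0"
    using zero_of_partial_derivative_sign_change
        [of \<epsilon>0 k1 "\<lambda>t y \<phi>. D (t, y, \<phi>)", OF deriv zero contD0 contk ab \<epsilon>0]
    by blast
  \<comment> \<open>At the origin every phase is a zero, so the prescribed value there is admissible.\<close>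
  define \<phi>fun where
    "\<phi>fun = (\<lambda>\<epsilon> k0. if \<epsilon> = 0 \<and> k0 = 0 then \<phi>star else SOME \<phi>. k1 \<epsilon> k0 \<phi> = 0)"
  have "k1 \<epsilon> k0 (\<phi>fun \<epsilon> k0) = 0" if "\<epsilon> \<in> {0..d}" "k0 \<in> {0..d}" for \<epsilon> k0
    using someI_ex[OF d(3)[of \<epsilon> k0]] that zero[of 0] \<epsilon>0 by (auto simp: \<phi>fun_def)
  moreover have "\<phi>fun 0 0 = \<phi>star"
    by (simp add: \<phi>fun_def)
  ultimately show ?thesis
    using d(1,2) by blast
qed

end
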